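(* If $D$ is an arc-weighted directed multigraph, then $\tau_t(D)\le 1.8\,\nu^*_t(D)$.
   Context: A directed multigraph may contain parallel arcs and bigons (but no loops). It is arc-weighted if each arc $e$ has a non-negative weight $w(e)$. A (directed) triangle is a triple of arcs of the form $uv, vw, wu$ on three distinct vertices; $T(D)$ is the set of triangles. $\tau_t(D)$ is the minimum total weight of a set $F$ of arcs such that $D\setminus F$ contains no directed triangle. A fractional triangle packing is a function $m:T(D)\to[0,\infty)$ such that for every arc $e$, the sum of $m(T)$ over triangles $T$ containing $e$ is at most $w(e)$; its weight is $\sum_{T\in T(D)} m(T)$, and $\nu^*_t(D)$ is the maximum weight of a fractional triangle packing. *)

theory Defs
  imports "HOL-Analysis.Function_Topology" "Graph_Theory.Digraph"
begin

definition del_arcs :: "('a,'b) pre_digraph \<Rightarrow> 'b set \<Rightarrow> ('a,'b) pre_digraph" where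
  "del_arcs D F = D\<lparr>arcs := arcs D - F\<rparr>"

(* A triangle is identified with its set of three arcs: the cyclic rotations of a triple are one
   triangle, while triangles on the same vertices through different parallel arcs are distinct. *)
definition triangles :: "('a,'b) pre_digraph \<Rightarrow> 'b set set" where
  "triangles D = {{e, f, g} | e f g. {e, f, g} \<subseteq> arcs D \<and>
     (\<exists>u v w. distinct [u, v, w] \<and> arc_to_ends D e = (u, v) \<and>
        arc_to_ends D f = (v, w) \<and> arc_to_ends D g = (w, u))}"

definition tau_t :: "('a,'b) pre_digraph \<Rightarrow> ('b \<Rightarrow> real) \<Rightarrow> real" where
  "tau_t D w = Min {sum w F | F. F \<subseteq> arcs D \<and> triangles (del_arcs D F) = {}}"

(* Values of m outside the set of triangles are irrelevant. *)
definition fractional_triangle_packing ::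
    "('a,'b) pre_digraph \<Rightarrow> ('b \<Rightarrow> real) \<Rightarrow> ('b set \<Rightarrow> real) \<Rightarrow> bool" where
  "fractional_triangle_packing D w m \<longleftrightarrow>
     (\<forall>T\<in>triangles D. 0 \<le> m T) \<and>
     (\<forall>e\<in>arcs D. (\<Sum>T | T \<in> triangles D \<and> e \<in> T. m T) \<le> w e)"

(* The supremum is a maximum for finite D and non-negative w: see nu_t_star_attained below. *)
definition nu_t_star :: "('a,'b) pre_digraph \<Rightarrow> ('b \<Rightarrow> real) \<Rightarrow> real" where
  "nu_t_star D w = Sup {\<Sum>T\<in>triangles D. m T | m. fractional_triangle_packing D w m}"

lemma (in fin_digraph) finite_triangles: "finite (triangles G)"
  by (rule finite_subset[of _ "Pow (arcs G)"]) (auto simp: triangles_def)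

lemma (in fin_digraph) tau_t_attained:
  "\<exists>F \<subseteq> arcs G. triangles (del_arcs G F) = {} \<and> tau_t G w = sum w F"
proof -
  let ?S = "{sum w F | F. F \<subseteq> arcs G \<and> triangles (del_arcs G F) = {}}"
  have "?S \<subseteq> sum w ` Pow (arcs G)" by auto
  then have "finite ?S" by (rule finite_subset) simp
  moreover have "triangles (del_arcs G (arcs G)) = {}"
    by (auto simp: triangles_def del_arcs_def)
  then have "?S \<noteq> {}" by blast
  ultimately have "tau_t G w \<in> ?S" unfolding tau_t_def by (rule Min_in)
  then show ?thesis by blast
qed

lemma (in fin_digraph) nu_t_star_attained:
  assumes w: "\<And>e. e \<in> arcs G \<Longrightarrow> 0 \<le> w e"
  shows "\<exists>m. fractional_triangle_packing G w m \<and> nu_t_star G w = (\<Sum>T\<in>triangles G. m T) \<and>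
    (\<forall>m'. fractional_triangle_packing G w m' \<longrightarrow>
       (\<Sum>T\<in>triangles G. m' T) \<le> (\<Sum>T\<in>triangles G. m T))"
proof -
  let ?T = "triangles G"
  let ?wt = "\<lambda>m :: 'b set \<Rightarrow> real. \<Sum>T\<in>?T. m T"
  define B where "B = sum w (arcs G)"
  define K where "K = {m. fractional_triangle_packing G w m}"
  define P where "P = (\<Pi>\<^sub>E T\<in>UNIV. if T \<in> ?T then {0..B} else {0::real})"
  have fin: "finite ?T" by (rule finite_triangles)
  have cont: "continuous_on UNIV (\<lambda>m :: 'b set \<Rightarrow> real. \<Sum>T\<in>A. m T)" for A
    by (intro continuous_on_sum continuous_on_product_coordinates)
  have "compactin (product_topology (\<lambda>_. euclidean) UNIV) P"
    unfolding P_def by (subst compactin_PiE) auto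
  then have "compact P" by (simp add: euclidean_product_topology)
  moreover have "K = (\<Inter>T\<in>?T. {m. 0 \<le> m T}) \<inter>
      (\<Inter>e\<in>arcs G. {m. (\<Sum>T | T \<in> ?T \<and> e \<in> T. m T) \<le> w e})"
    by (auto simp: K_def fractional_triangle_packing_def)
  then have "closed K"
    by (auto intro!: closed_Int closed_INT closed_Collect_le cont
        continuous_on_product_coordinates)
  ultimately have "compact (K \<inter> P)" by (subst Int_commute) (rule compact_Int_closed)
  moreover have "(\<lambda>_. 0) \<in> K \<inter> P"
    using w sum_nonneg[of "arcs G" w]
    by (auto simp: K_def P_def B_def fractional_triangle_packing_def)
  then have "K \<inter> P \<noteq> {}" by blast
  moreover have "continuous_on (K \<inter> P) ?wt"
    by (rule continuous_on_subset[OF cont]) simp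
  ultimately obtain m where m: "m \<in> K \<inter> P" "\<And>m'. m' \<in> K \<inter> P \<Longrightarrow> ?wt m' \<le> ?wt m"
    using continuous_attains_sup[of "K \<inter> P" ?wt] by blast
  have max: "?wt m' \<le> ?wt m" if m': "m' \<in> K" for m'
  proof -
    define m0 where "m0 T = (if T \<in> ?T then m' T else 0)" for T
    have "(\<Sum>T | T \<in> ?T \<and> e \<in> T. m0 T) = (\<Sum>T | T \<in> ?T \<and> e \<in> T. m' T)" for e
      by (rule sum.cong) (auto simp: m0_def)
    then have "m0 \<in> K"
      using m' by (simp add: K_def fractional_triangle_packing_def) (simp add: m0_def)
    moreover have "m0 T \<in> (if T \<in> ?T then {0..B} else {0})" for T
    proof (cases "T \<in> ?T")
      case True
      then obtain e where e: "e \<in> T" "e \<in> arcs G" by (auto simp: triangles_def)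
      have "m' T \<le> (\<Sum>S | S \<in> ?T \<and> e \<in> S. m' S)"
        using m' True e fin
        by (intro member_le_sum) (auto simp: K_def fractional_triangle_packing_def)
      also have "\<dots> \<le> w e" using m' e by (auto simp: K_def fractional_triangle_packing_def)
      also have "\<dots> \<le> B" unfolding B_def using w e by (intro member_le_sum) auto
      finally show ?thesis
        using m' True by (auto simp: m0_def K_def fractional_triangle_packing_def)
    qed (simp add: m0_def)
    then have "m0 \<in> P" by (auto simp: P_def PiE_iff)
    ultimately have "?wt m0 \<le> ?wt m" using m(2) by blast
    then show ?thesis by (simp add: m0_def cong: sum.cong)
  qed
  have "nu_t_star G w = ?wt m"
    unfolding nu_t_star_def using m(1) max
    by (intro cSup_eq_maximum) (auto simp: K_def)
  with m(1) max show ?thesis by (auto simp: K_def)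
qed

end

theory Submission
  imports Defs
begin

text \<open>
  By linear programming duality it suffices to round a fractional cover \<open>y\<close> of the triangles.
  Label the vertices independently and uniformly by \<open>{0, \<dots>, 4}\<close>. For a label difference \<open>d\<close> let
  \<open>C d\<close> be the probability that the difference of two labels is at most \<open>d\<close>, and remove an arc
  \<open>e\<close> from \<open>u\<close> to \<open>v\<close> if \<open>C (l v - l u) \<le> 1.8 * y e\<close>. As \<open>C\<close> is a distribution function, this
  happens with probability at most \<open>1.8 * y e\<close>. A surviving triangle would have label differences
  \<open>d\<close>, \<open>d'\<close>, \<open>d''\<close> with sum \<open>0\<close> and \<open>C d + C d' + C d'' > 1.8\<close>, which is impossible for five
  labels.
\<close>

section \<open>Approximate linear programming duality by a quadratic penalty\<close>

text \<open>The squared positive part has derivative \<open>2 * max 0 s\<close>, which is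
  2-Lipschitz, so the error of its linearisation is at most \<open>t\<^sup>2\<close>.\<close>

lemma pos_part_square_shift:
  fixes s t :: real
  shows "(max 0 (s - t))\<^sup>2 \<le> (max 0 s)\<^sup>2 - 2 * t * max 0 s + t\<^sup>2"
proof (cases "s \<ge> 0"; cases "s - t \<ge> 0")
  assume "\<not> s \<ge> 0" "s - t \<ge> 0"
  then have "(s - t)\<^sup>2 \<le> (- t)\<^sup>2" by (intro power_mono) auto
  then show ?thesis using \<open>\<not> s \<ge> 0\<close> \<open>s - t \<ge> 0\<close> by (simp add: max_def)
next
  assume "s \<ge> 0" "\<not> s - t \<ge> 0"
  moreover have "0 \<le> (s - t)\<^sup>2" by simp
  ultimately show ?thesis by (simp add: max_def power2_eq_square algebra_simps)
qed (auto simp: max_def power2_eq_square algebra_simps)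

text \<open>Divide by \<open>t\<close> and let \<open>t\<close> tend to 0 from the right. This
  extracts first-order optimality conditions from one-sided perturbations of a minimiser.\<close>

lemma linear_coeff_nonneg:
  fixes a c d :: real
  assumes "d > 0" and ge: "\<And>t. 0 < t \<Longrightarrow> t \<le> d \<Longrightarrow> 0 \<le> t * a + c * t\<^sup>2"
  shows "0 \<le> a"
proof -
  have "((\<lambda>t. a + c * t) \<longlongrightarrow> a + c * 0) (at_right 0)"
    by (intro tendsto_intros)
  moreover have "\<forall>\<^sub>F t in at_right 0. 0 \<le> a + c * t"
    unfolding eventually_at_right_field
  proof (intro exI conjI allI impI)
    show "0 < d" by fact
    fix t :: real assume t: "0 < t" "t < d"
    then have "0 \<le> t * (a + c * t)"
      using ge[of t] by (simp add: power2_eq_square algebra_simps)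
    then show "0 \<le> a + c * t" using t by (simp add: zero_le_mult_iff)
  qed
  ultimately show ?thesis
    using tendsto_lowerbound by fastforce
qed

text \<open>
  Replacing the covering constraints by a quadratic penalty on the dual side makes the minimiser
  \<open>y\<close> an almost feasible cover, and the derivatives of the penalty an exactly feasible packing.
\<close>

lemma approximate_packing_covering_duality:
  fixes w :: "'b \<Rightarrow> real" and \<epsilon> :: real
  assumes fin: "finite E" and H: "H \<subseteq> Pow E" "{} \<notin> H"
    and w: "\<And>e. e \<in> E \<Longrightarrow> 0 \<le> w e" and \<epsilon>: "\<epsilon> > 0"
  obtains m y where
    "\<And>T. T \<in> H \<Longrightarrow> 0 \<le> m T" "\<And>e. e \<in> E \<Longrightarrow> (\<Sum>T | T \<in> H \<and> e \<in> T. m T) \<le> w e"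
    "\<And>e. e \<in> E \<Longrightarrow> 0 \<le> y e" "\<And>T. T \<in> H \<Longrightarrow> 1 - \<epsilon> \<le> sum y T"
    "(\<Sum>e\<in>E. w e * y e) \<le> sum m H"
proof -
  \<comment> \<open>Large enough that \<open>L * pen y T \<le> sum w E\<close> forces
    \<open>pen y T \<le> \<epsilon>\<close>; the \<open>+ 1\<close> keeps \<open>L\<close> positive
    when all weights are 0.\<close>
  define L where "L = (sum w E + 1) / \<epsilon>"
  \<comment> \<open>Coordinates outside \<open>E\<close> are pinned to 0, so that the box is compact
    in the full product space and a minimiser exists.\<close>
  define P where "P = (\<Pi>\<^sub>E e\<in>UNIV. if e \<in> E then {0..1} else {0::real})"
  define pen where "pen y T = max 0 (1 - sum y T)" for y :: "'b \<Rightarrow> real" and T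
  define \<Phi> where "\<Phi> y = (\<Sum>e\<in>E. w e * y e) + L / 2 * (\<Sum>T\<in>H. (pen y T)\<^sup>2)" for y
  have w0: "0 \<le> sum w E" by (intro sum_nonneg w)
  then have L: "L > 0" using \<epsilon> by (simp add: L_def)
  have finH: "finite H" using fin H by (meson finite_Pow_iff finite_subset)
  have finT: "finite T" if "T \<in> H" for T using that fin H by (meson PowD finite_subset subsetD)
  have "compactin (product_topology (\<lambda>_. euclidean) UNIV) P"
    unfolding P_def by (subst compactin_PiE) auto
  then have "compact P" by (simp add: euclidean_product_topology)
  moreover have "(\<lambda>_. 0) \<in> P" by (auto simp: P_def)
  then have "P \<noteq> {}" by blast
  moreover have "continuous_on P (\<lambda>z. z e)" for e :: 'b
    by (rule continuous_on_subset[OF continuous_on_product_coordinates]) simp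
  then have "continuous_on P \<Phi>"
    unfolding \<Phi>_def pen_def
    by (intro continuous_on_add continuous_on_sum continuous_on_mult continuous_on_power
        continuous_on_max continuous_on_diff continuous_on_const)
  ultimately obtain y where y: "y \<in> P" and min: "\<And>z. z \<in> P \<Longrightarrow> \<Phi> y \<le> \<Phi> z"
    using continuous_attains_inf[of P \<Phi>] by blast
  define m where "m T = L * pen y T" for T
  have P_iff: "z \<in> P \<longleftrightarrow> (\<forall>e. if e \<in> E then 0 \<le> z e \<and> z e \<le> 1 else z e = 0)" for z
    by (simp add: P_def PiE_UNIV_domain Pi_iff if_distrib[of "(\<in>) _"] cong: if_cong)
  have y0: "0 \<le> y e" for e using y unfolding P_iff by (metis order_refl)
  have m0: "0 \<le> m T" for T using L by (simp add: m_def pen_def)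
  let ?ld = "\<lambda>e. \<Sum>T | T \<in> H \<and> e \<in> T. m T"
  \<comment> \<open>The partial derivative of \<open>\<Phi>\<close> at \<open>y\<close> in direction
    \<open>e\<close> is \<open>w e - ?ld e\<close>; the quadratic term bounds the error, and
    \<open>t\<close> may be negative.\<close>
  have step: "0 \<le> t * (w e - ?ld e) + L / 2 * card {T \<in> H. e \<in> T} * t\<^sup>2"
    if e: "e \<in> E" and t: "0 \<le> y e + t" "y e + t \<le> 1" for e t
  proof -
    define z where "z = y(e := y e + t)"
    have "z \<in> P" using y e t unfolding P_iff z_def by auto
    have pen_z: "(pen z T)\<^sup>2 \<le> (pen y T)\<^sup>2 + (if e \<in> T then t\<^sup>2 - 2 * t * pen y T else 0)"
      if "T \<in> H" for T
    proof (cases "e \<in> T")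
      case True
      have "sum z T = sum y T + t"
        using True finT[OF that] by (simp add: z_def sum.remove[of T e])
      then have "pen z T = max 0 ((1 - sum y T) - t)" by (simp add: pen_def)
      then show ?thesis
        using True pos_part_square_shift[of "1 - sum y T" t] by (simp add: pen_def)
    next
      case False
      then have "sum z T = sum y T" by (intro sum.cong) (auto simp: z_def)
      then show ?thesis using False by (simp add: pen_def)
    qed
    have "(\<Sum>T\<in>H. (pen z T)\<^sup>2) \<le>
        (\<Sum>T\<in>H. (pen y T)\<^sup>2 + (if e \<in> T then t\<^sup>2 - 2 * t * pen y T else 0))"
      by (intro sum_mono pen_z)
    also have "\<dots> = (\<Sum>T\<in>H. (pen y T)\<^sup>2) + (\<Sum>T | T \<in> H \<and> e \<in> T. t\<^sup>2 - 2 * t * pen y T)"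
      by (simp add: sum.distrib sum.inter_filter[OF finH])
    also have "\<dots> = (\<Sum>T\<in>H. (pen y T)\<^sup>2) + card {T \<in> H. e \<in> T} * t\<^sup>2
        - 2 * t * (\<Sum>T | T \<in> H \<and> e \<in> T. pen y T)"
      by (simp add: sum_subtractf sum_distrib_left)
    finally have "L / 2 * (\<Sum>T\<in>H. (pen z T)\<^sup>2) \<le> L / 2 * ((\<Sum>T\<in>H. (pen y T)\<^sup>2)
        + card {T \<in> H. e \<in> T} * t\<^sup>2 - 2 * t * (\<Sum>T | T \<in> H \<and> e \<in> T. pen y T))"
      using L by (intro mult_left_mono) auto
    also have "\<dots> = L / 2 * (\<Sum>T\<in>H. (pen y T)\<^sup>2) + L / 2 * card {T \<in> H. e \<in> T} * t\<^sup>2 - t * ?ld e"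
      by (simp add: m_def sum_distrib_left[symmetric] algebra_simps)
    finally have "L / 2 * (\<Sum>T\<in>H. (pen z T)\<^sup>2) \<le> \<dots>" .
    moreover have "(\<Sum>e\<in>E. w e * z e) = (\<Sum>e\<in>E. w e * y e) + t * w e"
    proof -
      have "(\<Sum>x\<in>E - {e}. w x * z x) = (\<Sum>x\<in>E - {e}. w x * y x)"
        by (intro sum.cong) (auto simp: z_def)
      then show ?thesis
        using e fin by (simp add: sum.remove[of E e] z_def algebra_simps)
    qed
    moreover have "\<Phi> y \<le> \<Phi> z" by (rule min) fact
    ultimately show ?thesis by (simp add: \<Phi>_def algebra_simps)
  qed
  have feasible: "?ld e \<le> w e" if e: "e \<in> E" for e
  proof (cases "y e < 1")
    case True
    have "0 \<le> w e - ?ld e"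
      by (rule linear_coeff_nonneg[of "1 - y e" _ "L / 2 * card {T \<in> H. e \<in> T}"])
         (use True step[OF e] y0[of e] in auto)
    then show ?thesis by simp
  next
    \<comment> \<open>Here \<open>y e\<close> has reached the upper bound 1 and cannot grow, but
      every member of \<open>H\<close> through \<open>e\<close> is already covered and has
      \<open>m T = 0\<close>.\<close>
    case False
    have "m T = 0" if "T \<in> H" "e \<in> T" for T
    proof -
      have "y e \<le> sum y T" using that finT y0 by (intro member_le_sum) auto
      then show ?thesis using False by (simp add: m_def pen_def)
    qed
    then show ?thesis using w[OF e] by simp
  qed
  \<comment> \<open>Complementary slackness: if \<open>y e > 0\<close>, moving down is allowed, so
    the derivative is at most 0 as well.\<close>
  have slack: "w e * y e = ?ld e * y e" if e: "e \<in> E" for e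
  proof (cases "y e = 0")
    case False
    have "0 \<le> ?ld e - w e"
    proof (rule linear_coeff_nonneg[of "y e" _ "L / 2 * card {T \<in> H. e \<in> T}"])
      show "0 < y e" using y0[of e] False by simp
      fix t :: real assume t: "0 < t" "t \<le> y e"
      have "y e \<le> 1" using y e unfolding P_iff by metis
      then show "0 \<le> t * (?ld e - w e) + L / 2 * card {T \<in> H. e \<in> T} * t\<^sup>2"
        using step[OF e, of "- t"] t by (simp add: algebra_simps)
    qed
    then show ?thesis using feasible[OF e] by simp
  qed simp
  show thesis
  proof (rule that[of m y])
    fix T assume T: "T \<in> H"
    then have "T \<noteq> {}" "T \<subseteq> E" using H by auto
    then obtain e where e: "e \<in> T" "e \<in> E" by blast
    have "m T \<le> ?ld e" using T e finH m0 by (intro member_le_sum) auto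
    also have "\<dots> \<le> w e" by (rule feasible) fact
    also have "\<dots> \<le> sum w E" using e fin w by (intro member_le_sum) auto
    also have "\<dots> \<le> L * \<epsilon>" using \<epsilon> by (simp add: L_def)
    finally have "pen y T \<le> \<epsilon>" using L by (simp add: m_def)
    then show "1 - \<epsilon> \<le> sum y T" by (simp add: pen_def)
  next
    \<comment> \<open>Slackness and an exchange of summation turn the cost of \<open>y\<close> into
      the total of \<open>m T * sum y T\<close>, where \<open>m T > 0\<close> only if
      \<open>sum y T < 1\<close>.\<close>
    have "(\<Sum>e\<in>E. w e * y e) = (\<Sum>e\<in>E. \<Sum>T\<in>H. if e \<in> T then m T * y e else 0)"
    proof (rule sum.cong)
      fix e assume "e \<in> E"
      then have "w e * y e = (\<Sum>T | T \<in> H \<and> e \<in> T. m T * y e)"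
        by (simp only: slack sum_distrib_right)
      then show "w e * y e = (\<Sum>T\<in>H. if e \<in> T then m T * y e else 0)"
        by (simp only: sum.inter_filter[OF finH])
    qed simp
    also have "\<dots> = (\<Sum>T\<in>H. \<Sum>e\<in>E. if e \<in> T then m T * y e else 0)"
      by (rule sum.swap)
    also have "\<dots> = (\<Sum>T\<in>H. m T * sum y T)"
    proof (rule sum.cong)
      fix T assume "T \<in> H"
      then have "{e \<in> E. e \<in> T} = T" using H by auto
      then show "(\<Sum>e\<in>E. if e \<in> T then m T * y e else 0) = m T * sum y T"
        by (simp only: sum.inter_filter[OF fin, symmetric] sum_distrib_left)
    qed simp
    also have "\<dots> \<le> sum m H"
    proof (rule sum_mono)
      fix T
      show "m T * sum y T \<le> m T"
      proof (cases "sum y T \<le> 1")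
        case True then show ?thesis using m0[of T] by (simp add: mult_left_le)
      qed (simp add: m_def pen_def)
    qed
    finally show "(\<Sum>e\<in>E. w e * y e) \<le> sum m H" .
  qed (use m0 y0 feasible in auto)
qed

section \<open>Ranks of label differences\<close>

text \<open>\<open>diff_rank i j\<close> is \<open>25 * C (j - i)\<close>; the inequality between labels avoids subtraction on \<open>nat\<close>.\<close>

definition diff_rank :: "nat \<Rightarrow> nat \<Rightarrow> nat" where
  "diff_rank i j = card {(a, b) \<in> {..<5} \<times> {..<5}. b + i \<le> a + j}"

text \<open>The differences -4, ..., 4 arise from 1, 2, 3, 4, 5, 4, 3, 2, 1 label pairs; the list
  holds the partial sums, shifted by 4 to index from 0.\<close>

lemma diff_rank_eq:
  assumes "i < 5" "j < 5"
  shows "diff_rank i j = [1, 3, 6, 10, 15, 19, 22, 24, 25] ! (4 + j - i)"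
proof -
  have "diff_rank i j = (\<Sum>(a, b)\<in>{..<5} \<times> {..<5}. if b + i \<le> a + j then 1 else 0)"
    by (simp add: diff_rank_def case_prod_beta' mem_Times_iff sum.inter_filter[symmetric])
  then have eq: "diff_rank i j = (\<Sum>a<5. \<Sum>b<5. if b + i \<le> a + j then 1 else 0)"
    by (simp add: sum.cartesian_product)
  have "i \<in> {0, 1, 2, 3, 4}" "j \<in> {0, 1, 2, 3, 4}" using assms by auto
  then show ?thesis unfolding eq by (elim insertE emptyE) (simp_all add: lessThan_nat_numeral lessThan_Suc)
qed

text \<open>Checked over all label triples; \<open>45 = 25 * 1.8\<close> is the source of the factor
  1.8. Equality occurs for the differences 0, 0, 0 and 2, 2, -4.\<close>

lemma diff_rank_cyclic_sum:
  assumes "i < 5" "j < 5" "k < 5"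
  shows "diff_rank i j + diff_rank j k + diff_rank k i \<le> 45"
proof -
  have "i \<in> {0, 1, 2, 3, 4}" "j \<in> {0, 1, 2, 3, 4}" "k \<in> {0, 1, 2, 3, 4}" using assms by auto
  then show ?thesis by (elim insertE emptyE) (simp_all add: diff_rank_eq)
qed

text \<open>A distribution function evaluated at its own random variable is at most \<open>t\<close>
  with probability at most \<open>t\<close>; here both sides are scaled by 25.\<close>

lemma card_diff_rank_le:
  fixes t :: real
  assumes "0 \<le> t"
  shows "card {(i, j) \<in> {..<5} \<times> {..<5}. diff_rank i j \<le> t} \<le> t"
proof -
  let ?S = "{(i, j) \<in> {..<5} \<times> {..<5}. diff_rank i j \<le> t}"
  show ?thesis
  proof (cases "?S = {}")
    case False
    let ?d = "\<lambda>(i, j). int j - int i"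
    have fin: "finite ?S" by (rule finite_subset[of _ "{..<5} \<times> {..<5}"]) auto
    then have "Max (?d ` ?S) \<in> ?d ` ?S" using False by (intro Max_in) auto
    \<comment> \<open>Every pair in \<open>?S\<close> has at most the difference of this extremal
      pair, hence is among those counted by its rank.\<close>
    then obtain i j where ij: "(i, j) \<in> ?S" "int j - int i = Max (?d ` ?S)" by auto
    have "int b - int a \<le> int j - int i" if "(a, b) \<in> ?S" for a b
      unfolding ij(2) using that fin by (intro Max_ge) (auto intro: image_eqI[of _ _ "(a, b)"])
    then have "?S \<subseteq> {(a, b) \<in> {..<5} \<times> {..<5}. b + i \<le> a + j}" by fastforce
    moreover have "finite {(a, b) \<in> {..<5} \<times> {..<5}. b + i \<le> a + j}"
      by (rule finite_subset[of _ "{..<5} \<times> {..<5}"]) auto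
    ultimately have "card ?S \<le> diff_rank i j"
      unfolding diff_rank_def by (rule card_mono[rotated])
    then have "real (card ?S) \<le> real (diff_rank i j)" by (simp only: of_nat_le_iff)
    also have "\<dots> \<le> t" using ij(1) by simp
    finally show ?thesis .
  qed (simp only: card.empty, use assms in simp)
qed

section \<open>Counting labellings of the vertices\<close>

lemma sum_PiE_insert:
  assumes "x \<notin> I"
  shows "(\<Sum>f\<in>insert x I \<rightarrow>\<^sub>E A. h f) = (\<Sum>a\<in>A. \<Sum>f\<in>I \<rightarrow>\<^sub>E A. h (f(x := a)))"
proof -
  have "(\<Sum>f\<in>insert x I \<rightarrow>\<^sub>E A. h f) = (\<Sum>(a, f)\<in>A \<times> (I \<rightarrow>\<^sub>E A). h (f(x := a)))"
    unfolding PiE_insert_eq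
    by (subst sum.reindex[OF inj_combinator[OF assms]]) (simp add: case_prod_beta)
  then show ?thesis by (simp add: sum.cartesian_product)
qed

text \<open>Two distinct coordinates of a uniformly random function are independent and uniform.
  Cross-multiplying keeps the identity in the naturals.\<close>

lemma card_PiE_pair:
  assumes "finite V" "u \<in> V" "v \<in> V" "u \<noteq> v" and "finite A" "A \<noteq> {}"
  shows "card {l \<in> V \<rightarrow>\<^sub>E A. R (l u) (l v)} * (card A)\<^sup>2 =
    card {(a, b) \<in> A \<times> A. R a b} * card (V \<rightarrow>\<^sub>E A)"
proof -
  define W where "W = V - {u, v}"
  have V: "V = insert u (insert v W)" "u \<notin> insert v W" "v \<notin> W" "v \<noteq> u" "finite W"
    using assms by (auto simp: W_def)
  have fin: "finite (V \<rightarrow>\<^sub>E A)" using assms by (intro finite_PiE) auto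
  have "card {l \<in> V \<rightarrow>\<^sub>E A. R (l u) (l v)} = (\<Sum>l\<in>V \<rightarrow>\<^sub>E A. if R (l u) (l v) then 1 else 0)"
    using fin by (simp add: sum.inter_filter[symmetric])
  also have "\<dots> = (\<Sum>a\<in>A. \<Sum>b\<in>A. card (W \<rightarrow>\<^sub>E A) * (if R a b then 1 else 0))"
    using V(2-4) unfolding V(1) by (simp add: sum_PiE_insert)
  also have "\<dots> = card (W \<rightarrow>\<^sub>E A) * (\<Sum>(a, b)\<in>A \<times> A. if R a b then 1 else 0)"
    by (simp only: sum_distrib_left[symmetric] sum.cartesian_product)
  also have "(\<Sum>(a, b)\<in>A \<times> A. if R a b then 1 else 0) = card {(a, b) \<in> A \<times> A. R a b}"
    using assms by (simp add: case_prod_beta' mem_Times_iff sum.inter_filter[symmetric])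
  finally show ?thesis
    using V by (simp add: V(1) card_PiE power2_eq_square)
qed

section \<open>Rounding a fractional triangle cover\<close>

lemma (in fin_digraph) tau_t_le:
  assumes "F \<subseteq> arcs G" "triangles (del_arcs G F) = {}"
  shows "tau_t G w \<le> sum w F"
proof -
  let ?S = "{sum w F | F. F \<subseteq> arcs G \<and> triangles (del_arcs G F) = {}}"
  have "?S \<subseteq> sum w ` Pow (arcs G)" by auto
  then have "finite ?S" by (rule finite_subset) simp
  then show ?thesis unfolding tau_t_def using assms by (intro Min_le) auto
qed

lemma triangles_E:
  assumes "T \<in> triangles G"
  obtains e f g u v x where "T = {e, f, g}" "e \<in> arcs G" "f \<in> arcs G" "g \<in> arcs G"
    "u \<noteq> v" "v \<noteq> x" "x \<noteq> u" "tail G e = u" "head G e = v" "tail G f = v" "head G f = x"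
    "tail G g = x" "head G g = u"
  using assms unfolding triangles_def arc_to_ends_def by auto

lemma (in loopfree_digraph) tau_t_le_fractional_cover:
  fixes w y :: "'b \<Rightarrow> real"
  assumes "fin_digraph G" and w: "\<And>e. e \<in> arcs G \<Longrightarrow> 0 \<le> w e"
    and y: "\<And>e. e \<in> arcs G \<Longrightarrow> 0 \<le> y e" and cover: "\<And>T. T \<in> triangles G \<Longrightarrow> 1 \<le> sum y T"
  shows "tau_t G w \<le> 1.8 * (\<Sum>e\<in>arcs G. w e * y e)"
proof -
  interpret fin_digraph G by fact
  let ?\<L> = "verts G \<rightarrow>\<^sub>E {..<5::nat}"
  \<comment> \<open>The threshold factor is \<open>25 * 1.8 = 45\<close>, since
    \<open>diff_rank\<close> counts among 25 pairs.\<close>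
  define F where "F l = {e \<in> arcs G. diff_rank (l (tail G e)) (l (head G e)) \<le> 45 * y e}" for l
  have finL: "finite ?\<L>" by (intro finite_PiE) auto
  have card_pos: "card ?\<L> > 0" by (simp add: card_PiE)
  have F_cover: "tau_t G w \<le> sum w (F l)" if l: "l \<in> ?\<L>" for l
  proof (rule tau_t_le)
    have False if T: "T \<in> triangles (del_arcs G (F l))" for T
    proof -
      obtain e f g u v x where efg: "T = {e, f, g}" "e \<in> arcs G - F l" "f \<in> arcs G - F l"
          "g \<in> arcs G - F l" "u \<noteq> v" "v \<noteq> x" "x \<noteq> u" "tail G e = u" "head G e = v"
          "tail G f = v" "head G f = x" "tail G g = x" "head G g = u"
        using T by (rule triangles_E) (auto simp: del_arcs_def)
      have "T \<in> triangles G"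
        using efg unfolding triangles_def arc_to_ends_def by fastforce
      \<comment> \<open>The three tails are distinct, hence so are the arcs, and no term of the sum
        collapses.\<close>
      moreover have "e \<noteq> f" "f \<noteq> g" "e \<noteq> g" using efg by metis+
      then have "sum y T = y e + y f + y g" using efg by simp
      ultimately have "1 \<le> y e + y f + y g" using cover by metis
      moreover have "45 * y e < diff_rank (l u) (l v)" "45 * y f < diff_rank (l v) (l x)"
          "45 * y g < diff_rank (l x) (l u)"
        using efg by (auto simp: F_def)
      moreover have "u \<in> verts G" "v \<in> verts G" "x \<in> verts G" using efg by auto
      then have "l u < 5" "l v < 5" "l x < 5" using l by auto
      note diff_rank_cyclic_sum[OF this]
      ultimately show False by linarith
    qed
    then show "triangles (del_arcs G (F l)) = {}" by blast
  qed (auto simp: F_def)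
  have arc_count: "card {l \<in> ?\<L>. e \<in> F l} \<le> 1.8 * y e * card ?\<L>" if e: "e \<in> arcs G" for e
  proof -
    let ?u = "tail G e" and ?v = "head G e"
    have "{l \<in> ?\<L>. e \<in> F l} = {l \<in> ?\<L>. diff_rank (l ?u) (l ?v) \<le> 45 * y e}"
      using e by (auto simp: F_def)
    \<comment> \<open>Without loops the endpoints are distinct, so their labels are
      independent.\<close>
    moreover have "card {l \<in> ?\<L>. diff_rank (l ?u) (l ?v) \<le> 45 * y e} * (card {..<5::nat})\<^sup>2 =
        card {(i, j) \<in> {..<5} \<times> {..<5}. diff_rank i j \<le> 45 * y e} * card ?\<L>"
      using e no_loops by (intro card_PiE_pair) (auto simp: lessThan_empty_iff)
    ultimately have "real (card {l \<in> ?\<L>. e \<in> F l}) * 25 =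
        card {(i, j) \<in> {..<5} \<times> {..<5}. diff_rank i j \<le> 45 * y e} * real (card ?\<L>)"
      by (simp flip: of_nat_mult)
    also have "\<dots> \<le> 45 * y e * card ?\<L>"
      using y[OF e] by (intro mult_right_mono card_diff_rank_le) auto
    finally show ?thesis by simp
  qed
  \<comment> \<open>Averaging over labellings: count the pairs of a labelling and an arc it removes,
    weighted by \<open>w\<close>, in two ways.\<close>
  have "card ?\<L> * tau_t G w \<le> (\<Sum>l\<in>?\<L>. sum w (F l))"
    using sum_mono[of ?\<L> "\<lambda>_. tau_t G w", OF F_cover] by simp
  also have "\<dots> = (\<Sum>l\<in>?\<L>. \<Sum>e\<in>arcs G. if e \<in> F l then w e else 0)"
    by (simp add: F_def sum.inter_filter cong: sum.cong)
  also have "\<dots> = (\<Sum>e\<in>arcs G. \<Sum>l\<in>?\<L>. if e \<in> F l then w e else 0)"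
    by (rule sum.swap)
  also have "\<dots> = (\<Sum>e\<in>arcs G. w e * card {l \<in> ?\<L>. e \<in> F l})"
    using finL by (simp add: sum.inter_filter[symmetric] mult.commute)
  also have "\<dots> \<le> (\<Sum>e\<in>arcs G. w e * (1.8 * y e * card ?\<L>))"
    by (intro sum_mono mult_left_mono arc_count w)
  also have "\<dots> = card ?\<L> * (1.8 * (\<Sum>e\<in>arcs G. w e * y e))"
    by (simp add: sum_distrib_left algebra_simps)
  finally show ?thesis using card_pos by simp
qed

section \<open>Combining rounding and duality in the limit\<close>

theorem theorem3:
  fixes D :: "('a, 'b) pre_digraph" and w :: "'b \<Rightarrow> real"
  assumes "fin_digraph D" and "loopfree_digraph D"
    and "\<And>e. e \<in> arcs D \<Longrightarrow> 0 \<le> w e"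
  shows "tau_t D w \<le> 1.8 * nu_t_star D w"
proof -
  interpret fin_digraph D by fact
  interpret loopfree_digraph D by fact
  let ?\<tau> = "tau_t D w" and ?\<nu> = "nu_t_star D w"
  \<comment> \<open>Dividing \<open>y\<close> by \<open>1 - \<epsilon>\<close> gives an exact cover
    at the cost of that factor, which disappears as \<open>\<epsilon>\<close> tends to 0.\<close>
  have approx: "(1 - \<epsilon>) * ?\<tau> \<le> 1.8 * ?\<nu>" if \<epsilon>: "0 < \<epsilon>" "\<epsilon> < 1" for \<epsilon>
  proof -
    obtain m y where my: "\<And>T. T \<in> triangles D \<Longrightarrow> 0 \<le> m T"
        "\<And>e. e \<in> arcs D \<Longrightarrow> (\<Sum>T | T \<in> triangles D \<and> e \<in> T. m T) \<le> w e"
        "\<And>e. e \<in> arcs D \<Longrightarrow> 0 \<le> y e" "\<And>T. T \<in> triangles D \<Longrightarrow> 1 - \<epsilon> \<le> sum y T"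
        "(\<Sum>e\<in>arcs D. w e * y e) \<le> sum m (triangles D)"
      using approximate_packing_covering_duality[of "arcs D" "triangles D" w \<epsilon>] assms(3) \<epsilon>
      by (auto simp: triangles_def)
    have "fractional_triangle_packing D w m"
      using my by (simp add: fractional_triangle_packing_def)
    then have le_nu: "sum m (triangles D) \<le> ?\<nu>"
      using nu_t_star_attained[OF assms(3)] by fastforce
    have "?\<tau> \<le> 1.8 * (\<Sum>e\<in>arcs D. w e * (y e / (1 - \<epsilon>)))"
      using assms my \<epsilon>
      by (intro tau_t_le_fractional_cover) (auto simp: sum_divide_distrib[symmetric])
    also have "\<dots> = 1.8 * (\<Sum>e\<in>arcs D. w e * y e) / (1 - \<epsilon>)"
      by (simp add: sum_divide_distrib sum_distrib_left)
    finally have "(1 - \<epsilon>) * ?\<tau> \<le> 1.8 * (\<Sum>e\<in>arcs D. w e * y e)"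
      using \<epsilon> by (simp add: field_simps)
    with my(5) le_nu show ?thesis by simp
  qed
  have "((\<lambda>\<epsilon>. (1 - \<epsilon>) * ?\<tau>) \<longlongrightarrow> (1 - 0) * ?\<tau>) (at_right 0)"
    by (intro tendsto_intros)
  moreover have "\<forall>\<^sub>F \<epsilon> in at_right 0. (1 - \<epsilon>) * ?\<tau> \<le> 1.8 * ?\<nu>"
    unfolding eventually_at_right_field using approx by (intro exI[of _ 1]) auto
  ultimately show ?thesis
    using tendsto_upperbound by fastforce
qed

end
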